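(* Let $K$ be a field, $n\ge 1$, and $f(X,Y)=a_0(X)+a_1(X)Y+\cdots+a_n(X)Y^n\in K[X,Y]$, with $a_0,\dots,a_n\in K[X]$, $a_0a_n\neq 0$. Assume that for two polynomials $a(X),b(X)\in K[X]$ we have $f(X,a(X))f(X,b(X))\neq 0$ and $$\Delta:=\tfrac12\left(\deg f(X,b(X))-\deg f(X,a(X))\right)\ge 0,$$ and let $$q=\max\{\deg d_2-\deg d_1\le\Delta\;:\; d_1\in D_{ad}(f(X,a(X))),\ d_2\in D_{ad}(f(X,b(X)))\}.$$ If $$\deg b(X)>\max\left\{\deg a(X),\ \max_{0\le i\le n-1}\frac{\deg a_i-\deg a_n}{n-i}\right\}+q,$$ then $f(X,Y)$, viewed as a polynomial in $Y$, is irreducible over $K(X)$.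
   Context: Admissible divisors: for $f(X,Y)\in K[X,Y]$ and $a(X)\in K[X]$ with $f(X,a(X))\neq 0$, a polynomial $d(X)\in K[X]$ is an admissible divisor of $f(X,a(X))$ if $d(X)\mid f(X,a(X))$ in $K[X]$ and $$\gcd\left(d(X),\frac{f(X,a(X))}{d(X)}\right)\ \Big|\ \gcd\left(f(X,a(X)),\frac{\partial f}{\partial Y}(X,a(X))\right).$$ The set of admissible divisors of $f(X,a(X))$ is denoted $D_{ad}(f(X,a(X)))$ (it depends on $f$ and $a(X)$). All degrees are in $X$, and the zero polynomial has degree $-\infty$. *)

theory Defs
  imports
    "HOL-Computational_Algebra.Computational_Algebra"
    "HOL-Library.Extended_Real"
begin

text \<open>
  The class \<open>gcd\<close> is available on polynomials only when the coefficient field carries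
  the extra structure of class \<open>field_gcd\<close>. To cover arbitrary fields, the library's
  Euclidean algorithm is interpreted in the polynomial ring. The result is the monic gcd
  (and 0 for two zero arguments).
\<close>

context
begin

interpretation field_poly: normalization_euclidean_semiring
  where zero = "0 :: 'a :: field poly"
    and one = 1 and plus = plus and minus = minus
    and times = times
    and normalize = "\<lambda>p. smult (inverse (lead_coeff p)) p"
    and unit_factor = "\<lambda>p. [:lead_coeff p:]"
    and euclidean_size = "\<lambda>p. if p = 0 then 0 else 2 ^ degree p"
    and divide = divide and modulo = modulo
  rewrites "dvd.dvd (times :: 'a poly \<Rightarrow> _) = Rings.dvd"
proof -
  show "dvd.dvd (times :: 'a poly \<Rightarrow> _) = Rings.dvd"
    by (simp add: dvd_dict)
  show "class.normalization_euclidean_semiring divide plus minus (0 :: 'a poly) times 1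
    modulo (\<lambda>p. if p = 0 then 0 else 2 ^ degree p)
    (\<lambda>p. [:lead_coeff p:]) (\<lambda>p. smult (inverse (lead_coeff p)) p)"
  proof (standard, fold dvd_dict)
    fix p :: "'a poly"
    show "[:lead_coeff p:] * smult (inverse (lead_coeff p)) p = p"
      by (cases "p = 0") simp_all
  next
    fix p :: "'a poly" assume "is_unit p"
    then show "[:lead_coeff p:] = p"
      by (elim is_unit_polyE) (auto simp: monom_0 one_poly_def field_simps)
  next
    fix p :: "'a poly" assume "p \<noteq> 0"
    then show "is_unit [:lead_coeff p:]"
      by (simp add: is_unit_pCons_iff)
  next
    fix a b :: "'a poly" assume "is_unit a"
    thus "[:lead_coeff (a * b):] = a * [:lead_coeff b:]"
      by (auto elim!: is_unit_polyE)
  qed (auto simp: lead_coeff_mult Rings.div_mult_mod_eq intro!: degree_mod_less' degree_mult_right_le)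
qed

definition poly_gcd :: "'a::field poly \<Rightarrow> 'a poly \<Rightarrow> 'a poly" where
  "poly_gcd = field_poly.gcd"

lemma poly_gcd_rec:
  "poly_gcd p q =
    (if q = 0 then smult (inverse (lead_coeff p)) p else poly_gcd q (p mod q))"
  unfolding poly_gcd_def by (rule field_poly.gcd.simps)

lemma dvd_poly_gcd_iff: "c dvd poly_gcd p q \<longleftrightarrow> c dvd p \<and> c dvd q"
proof (induct p q rule: field_poly.eucl_induct)
  case (zero p)
  show ?case
    using poly_gcd_rec [of p 0] by (cases "p = 0") (simp_all add: dvd_smult_iff)
next
  case (mod p q)
  have "c dvd poly_gcd p q \<longleftrightarrow> c dvd poly_gcd q (p mod q)"
    using mod(1) by (simp add: poly_gcd_rec [of p q])
  also have "\<dots> \<longleftrightarrow> c dvd q \<and> c dvd p mod q"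
    by (rule mod(2))
  also have "\<dots> \<longleftrightarrow> c dvd p \<and> c dvd q"
    using dvd_mod_iff [of c q p] by blast
  finally show ?case .
qed

end

lemma poly_gcd_dvd1: "poly_gcd p q dvd p"
  and poly_gcd_dvd2: "poly_gcd p q dvd q"
  using dvd_poly_gcd_iff [of "poly_gcd p q" p q] by auto

lemma poly_gcd_associated_gcd:
  fixes p q :: "'a::field_gcd poly"
  shows "poly_gcd p q dvd gcd p q" and "gcd p q dvd poly_gcd p q"
  by (simp_all add: dvd_poly_gcd_iff poly_gcd_dvd1 poly_gcd_dvd2)

text \<open>
  A polynomial of type \<open>'a poly poly\<close> is read as \<open>f(X,Y)\<close> with outer indeterminate \<open>Y\<close>:
  \<open>coeff f i\<close> is \<open>a\<^sub>i(X)\<close>, \<open>poly f a\<close> is \<open>f(X,a(X))\<close>, and \<open>pderiv f\<close> is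
  the partial derivative with respect to \<open>Y\<close>.
\<close>

definition admissible_divisors :: "'a::field poly poly \<Rightarrow> 'a poly \<Rightarrow> 'a poly set" where
  "admissible_divisors f a =
    {d. d dvd poly f a \<and>
        poly_gcd d (poly f a div d) dvd poly_gcd (poly f a) (poly (pderiv f) a)}"

text \<open>The library's \<open>degree\<close> sends 0 to 0; here the zero polynomial has degree \<open>-\<infinity>\<close>.\<close>

definition edegree :: "'a::zero poly \<Rightarrow> ereal" where
  "edegree p = (if p = 0 then - \<infinity> else ereal (real (degree p)))"

text \<open>
  The integers \<open>deg d\<^sub>2 - deg d\<^sub>1\<close> not exceeding \<open>\<Delta>\<close>. The library degree suffices
  here, as divisors of nonzero polynomials are nonzero.
\<close>

definition admissible_degree_diffs ::
    "'a::field poly poly \<Rightarrow> 'a poly \<Rightarrow> 'a poly \<Rightarrow> real \<Rightarrow> int set" where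
  "admissible_degree_diffs f a b \<Delta> =
    {int (degree d2) - int (degree d1) | d1 d2.
      d1 \<in> admissible_divisors f a \<and> d2 \<in> admissible_divisors f b \<and>
      real_of_int (int (degree d2) - int (degree d1)) \<le> \<Delta>}"

lemma one_admissible: "1 \<in> admissible_divisors f a"
proof -
  have "poly_gcd 1 (poly f a div 1) dvd 1"
    by (rule poly_gcd_dvd1)
  then show ?thesis
    unfolding admissible_divisors_def by (simp add: dvd_trans [OF _ one_dvd])
qed

lemma finite_admissible_degree_diffs:
  assumes "poly f a \<noteq> 0" and "poly f b \<noteq> 0"
  shows "finite (admissible_degree_diffs f a b \<Delta>)"
proof (rule finite_subset)
  show "admissible_degree_diffs f a b \<Delta> \<subseteq> {- int (degree (poly f a)) .. int (degree (poly f b))}"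
  proof
    fix k assume "k \<in> admissible_degree_diffs f a b \<Delta>"
    then obtain d1 d2 where k: "k = int (degree d2) - int (degree d1)"
      and "d1 dvd poly f a" "d2 dvd poly f b"
      unfolding admissible_degree_diffs_def admissible_divisors_def by blast
    with assms have "degree d1 \<le> degree (poly f a)" "degree d2 \<le> degree (poly f b)"
      by (simp_all add: dvd_imp_degree_le)
    with k show "k \<in> {- int (degree (poly f a)) .. int (degree (poly f b))}"
      by simp
  qed
qed simp

lemma zero_in_admissible_degree_diffs:
  "0 \<le> \<Delta> \<Longrightarrow> 0 \<in> admissible_degree_diffs f a b \<Delta>"
  unfolding admissible_degree_diffs_def
  by (rule CollectI, intro exI [of _ 1]) (simp add: one_admissible)

end

theory Submission
  imports Defs
begin

text \<open>
  By Gauss' lemma a nontrivial factorisation over \<open>K(X)\<close> yields one, \<open>f = g h\<close>, over \<open>K[X]\<close>.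
  Then \<open>g(X,a)\<close> is an admissible divisor of \<open>f(X,a)\<close>, because a common divisor of \<open>g(X,a)\<close> and
  \<open>h(X,a)\<close> divides \<open>f\<^sub>Y = g\<^sub>Y h + g h\<^sub>Y\<close> at \<open>Y = a\<close>; the same holds for \<open>h\<close> and for \<open>b\<close>.
  The increments \<open>deg g(X,b) - deg g(X,a)\<close> and \<open>deg h(X,b) - deg h(X,a)\<close> add up to \<open>2\<Delta>\<close>, so one of them
  is at most \<open>\<Delta>\<close>, hence at most \<open>q\<close>.

  On the other hand, let \<open>\<mu>\<close> be the maximum in the hypothesis. The leading term of \<open>f\<close> dominates
  in the Gauss norm \<open>max\<^sub>j (deg a\<^sub>j + j\<mu>)\<close>. As this norm is multiplicative, the leading terms of
  \<open>g\<close> and \<open>h\<close> dominate as well, so that \<open>deg g(X,a) \<le> deg (lc g) + m\<mu>\<close> and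
  \<open>deg g(X,b) = deg (lc g) + m deg b\<close> with \<open>m = deg\<^sub>Y g\<close>. The increment is therefore at least
  \<open>m (deg b - \<mu>) > q\<close>, a contradiction. This replaces the roots of \<open>f\<close> in an algebraic
  closure of \<open>K(X)\<close> by an argument about coefficients only.
\<close>

section \<open>Descent of factorisations from \<open>K(X)[Y]\<close> to
  \<open>K[X][Y]\<close>\<close>

lemma field_poly_prime_divisor_exists:
  fixes c :: "'a::field poly"
  assumes "c \<noteq> 0" "degree c > 0"
  obtains p where "prime_elem p" "p dvd c" "degree p > 0"
proof -
  let ?P = "\<lambda>p. p dvd c \<and> degree p > 0"
  from assms have "?P c" by simp
  then obtain p where p: "?P p" and min: "\<And>r. ?P r \<Longrightarrow> degree p \<le> degree r"
    using ex_has_least_nat[of ?P c degree] by blast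
  have nz: "p \<noteq> 0" using p by auto
  have "irreducible p"
  proof (rule irreducibleI)
    show "p \<noteq> 0" by (rule nz)
    show "\<not> p dvd 1" using p nz by (simp add: is_unit_iff_degree)
  next
    fix r s assume rs: "p = r * s"
    then have rs0: "r \<noteq> 0" "s \<noteq> 0" using nz by auto
    then have deg: "degree p = degree r + degree s" by (simp add: rs degree_mult_eq)
    have "r dvd c" "s dvd c" using p rs dvd_trans by (metis dvd_triv_left, metis dvd_triv_right)
    then have "degree r = 0 \<or> degree s = 0"
      using min[of r] min[of s] deg by linarith
    then show "r dvd 1 \<or> s dvd 1" using rs0 by (simp add: is_unit_iff_degree)
  qed
  then show thesis using that p field_poly_irreducible_imp_prime by blast
qed

text \<open>Primes of \<open>K[X]\<close> stay prime as constants of \<open>K[X][Y]\<close>, so each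
  prime factor of \<open>c\<close> divides \<open>g\<close> or \<open>h\<close> and can be cancelled
  there. This changes no degree in \<open>Y\<close>, and the degree of \<open>c\<close> in
  \<open>X\<close> drops.\<close>

lemma factorization_cancel_const:
  fixes f g h :: "'a::field poly poly"
  assumes "smult c f = g * h" "c \<noteq> 0"
  shows "\<exists>g' h'. f = g' * h' \<and> degree g' = degree g \<and> degree h' = degree h"
  using assms
proof (induction "degree c" arbitrary: c g h rule: less_induct)
  case less
  show ?case
  proof (cases "degree c = 0")
    case True
    then obtain u where c: "c = [:u:]" by (metis degree_eq_zeroE)
    with less.prems have u: "u \<noteq> 0" by auto
    \<comment> \<open>A nonzero constant \<open>u\<close> of \<open>K\<close> is a unit and is
      absorbed into \<open>g\<close>.\<close>
    have "f = smult [:inverse u:] (smult c f)" using u by (simp add: c one_pCons[symmetric])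
    also have "\<dots> = smult [:inverse u:] g * h" by (simp add: less.prems(1))
    finally show ?thesis using u
      by (intro exI[of _ "smult [:inverse u:] g"] exI[of _ h]) simp
  next
    case False
    then obtain p where p: "prime_elem p" "p dvd c" "degree p > 0"
      using field_poly_prime_divisor_exists less.prems(2) by auto
    then have p0: "p \<noteq> 0" by auto
    from p obtain c' where c': "c = p * c'" by (auto elim: dvdE)
    with less.prems have c0: "c' \<noteq> 0" by auto
    have lt: "degree c' < degree c" using p c0 p0 by (simp add: c' degree_mult_eq)
    have pd: "prime_elem [:p:]" by (rule lift_prime_elem_poly) fact
    have "g * h = [:p:] * smult c' f" using less.prems(1) by (simp add: c' ac_simps)
    then have "[:p:] dvd g \<or> [:p:] dvd h" using pd by (metis dvd_triv_left prime_elem_dvd_multD)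
    then show ?thesis
    proof
      assume "[:p:] dvd g"
      then obtain g1 where g1: "g = [:p:] * g1" by (elim dvdE)
      then have "[:p:] * smult c' f = [:p:] * (g1 * h)"
        using less.prems(1) by (simp add: c' ac_simps)
      then have "smult c' f = g1 * h" using p0 by (subst (asm) mult_cancel_left) simp
      from less.hyps[OF lt this c0] show ?thesis using g1 p0 by auto
    next
      assume "[:p:] dvd h"
      then obtain h1 where h1: "h = [:p:] * h1" by (elim dvdE)
      then have "[:p:] * smult c' f = [:p:] * (g * h1)"
        using less.prems(1) by (simp add: c' ac_simps)
      then have "smult c' f = g * h1" using p0 by (subst (asm) mult_cancel_left) simp
      from less.hyps[OF lt this c0] show ?thesis using h1 p0 by auto
    qed
  qed
qed

lemma fract_poly_clear_denominators:
  fixes G :: "'a::idom fract poly"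
  obtains c g where "c \<noteq> 0" "smult (to_fract c) G = fract_poly g"
proof -
  have "\<exists>c g. c \<noteq> 0 \<and> smult (to_fract c) G = fract_poly g"
  proof (induction G)
    case 0
    show ?case by (rule exI[of _ 1], rule exI[of _ 0]) simp
  next
    case (pCons r G)
    then obtain c g where c: "c \<noteq> 0" "smult (to_fract c) G = fract_poly g" by blast
    obtain x y where r: "r = Fract x y" "y \<noteq> 0" by (cases r)
    \<comment> \<open>The extra factor \<open>y\<close> clears the denominator of \<open>r\<close>,
      so that \<open>r\<close> = \<open>x / y\<close> becomes \<open>c * x\<close>.\<close>
    have "smult (to_fract (y * c)) G = fract_poly (smult y g)"
      by (simp flip: c(2))
    then have "smult (to_fract (y * c)) (pCons r G) = fract_poly (pCons (c * x) (smult y g))"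
      using r by (simp add: map_poly_pCons Fract_conv_to_fract)
    with c r show ?case by (intro exI[of _ "y * c"] exI[of _ "pCons (c * x) (smult y g)"]) simp
  qed
  then show thesis using that by blast
qed

lemma fract_poly_factorization:
  fixes f :: "'a::field poly poly"
  assumes "fract_poly f = G * H"
  obtains g h where "f = g * h" "degree g = degree G" "degree h = degree H"
proof -
  obtain c g where c: "c \<noteq> 0" "smult (to_fract c) G = fract_poly g"
    by (rule fract_poly_clear_denominators)
  obtain d h where d: "d \<noteq> 0" "smult (to_fract d) H = fract_poly h"
    by (rule fract_poly_clear_denominators)
  have "fract_poly (smult (c * d) f) = smult (to_fract c) G * smult (to_fract d) H"
    using assms by (simp add: mult.commute)
  also have "\<dots> = fract_poly (g * h)" by (simp add: c d)
  finally have "smult (c * d) f = g * h" by (simp only: fract_poly_eq_iff)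
  moreover have "degree g = degree G" "degree h = degree H"
    using arg_cong[OF c(2), of degree] arg_cong[OF d(2), of degree] c(1) d(1)
    by (simp_all add: degree_map_poly)
  ultimately show thesis
    using factorization_cancel_const[of "c * d" f g h] c(1) d(1) that by auto
qed

lemma poly_factor_admissible:
  assumes "f = g * h" "poly f a \<noteq> 0"
  shows "poly g a \<in> admissible_divisors f a"
proof -
  have fa: "poly f a = poly g a * poly h a" by (simp add: assms)
  with assms(2) have "poly f a div poly g a = poly h a" by simp
  moreover let ?d = "poly_gcd (poly g a) (poly h a)"
  have "?d dvd poly g a" "?d dvd poly h a" by (rule poly_gcd_dvd1, rule poly_gcd_dvd2)
  then have "?d dvd poly f a" "?d dvd poly (pderiv f) a"
    by (simp_all add: assms(1) pderiv_mult)
  ultimately show ?thesis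
    by (simp add: admissible_divisors_def fa dvd_poly_gcd_iff)
qed

section \<open>Gauss norm and dominance of the leading term\<close>

definition gauss_weight :: "real \<Rightarrow> 'a::zero poly poly \<Rightarrow> nat \<Rightarrow> real" where
  "gauss_weight \<mu> p j = real (degree (coeff p j)) + real j * \<mu>"

text \<open>For nonzero \<open>p\<close> this says that all roots in \<open>Y\<close> have degree at
  most \<mu>. Zero coefficients are excluded because \<open>degree 0 = 0\<close> would give them a
  spurious weight.\<close>

definition lead_dominant :: "real \<Rightarrow> 'a::zero poly poly \<Rightarrow> bool" where
  "lead_dominant \<mu> p \<longleftrightarrow>
    (\<forall>j. coeff p j \<noteq> 0 \<longrightarrow> gauss_weight \<mu> p j \<le> gauss_weight \<mu> p (degree p))"

text \<open>Choosing the largest among the maximising indices makes the inequality strict beyond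
  \<open>j\<close>; this tie-breaking isolates a single term in a product.\<close>

lemma last_maximal_weight:
  assumes "p \<noteq> 0"
  obtains j where "coeff p j \<noteq> 0"
    "\<And>i. coeff p i \<noteq> 0 \<Longrightarrow> gauss_weight \<mu> p i \<le> gauss_weight \<mu> p j"
    "\<And>i. coeff p i \<noteq> 0 \<Longrightarrow> j < i \<Longrightarrow> gauss_weight \<mu> p i < gauss_weight \<mu> p j"
proof -
  define S where "S = {i. coeff p i \<noteq> 0}"
  have fin: "finite S"
    unfolding S_def by (rule finite_subset[of _ "{..degree p}"]) (auto intro: le_degree)
  have ne: "S \<noteq> {}" using assms by (auto simp: S_def poly_eq_iff)
  define M where "M = Max (gauss_weight \<mu> p ` S)"
  define T where "T = {i \<in> S. gauss_weight \<mu> p i = M}"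
  have "M \<in> gauss_weight \<mu> p ` S" unfolding M_def using fin ne by (intro Max_in) auto
  then have T: "finite T" "T \<noteq> {}" using fin by (auto simp: T_def)
  then have "Max T \<in> T" by (rule Max_in)
  then have j: "coeff p (Max T) \<noteq> 0" "gauss_weight \<mu> p (Max T) = M" by (auto simp: T_def S_def)
  have le: "gauss_weight \<mu> p i \<le> M" if "coeff p i \<noteq> 0" for i
    unfolding M_def using fin that by (intro Max_ge) (auto simp: S_def)
  have "gauss_weight \<mu> p i < M" if "coeff p i \<noteq> 0" "Max T < i" for i
  proof -
    have "i \<notin> T" using T(1) that(2) Max_ge leD by blast
    then show ?thesis using le[OF that(1)] that(1) by (auto simp: T_def S_def)
  qed
  with that[of "Max T"] j le show thesis by auto
qed

text \<open>At the last maximal indices \<open>j\<close> and \<open>k\<close> the weights add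
  without cancellation, so \<open>?w g j + ?w h k\<close> is at most the leading weight of
  \<open>g * h\<close>, which is the sum of the two leading weights. Since that of \<open>h\<close>
  is at most \<open>?w h k\<close>, that of \<open>g\<close> is at least
  \<open>?w g j\<close>.\<close>

lemma lead_dominant_factor:
  fixes g h :: "'a::idom poly poly"
  assumes dom: "lead_dominant \<mu> (g * h)" and nz: "g * h \<noteq> 0"
  shows "lead_dominant \<mu> g"
proof -
  let ?w = "gauss_weight \<mu>"
  from nz have nz': "g \<noteq> 0" "h \<noteq> 0" by auto
  obtain j where j: "coeff g j \<noteq> 0" "\<And>i. coeff g i \<noteq> 0 \<Longrightarrow> ?w g i \<le> ?w g j"
    "\<And>i. coeff g i \<noteq> 0 \<Longrightarrow> j < i \<Longrightarrow> ?w g i < ?w g j"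
    using last_maximal_weight[OF nz'(1)] by blast
  obtain k where k: "coeff h k \<noteq> 0" "\<And>i. coeff h i \<noteq> 0 \<Longrightarrow> ?w h i \<le> ?w h k"
    "\<And>i. coeff h i \<noteq> 0 \<Longrightarrow> k < i \<Longrightarrow> ?w h i < ?w h k"
    using last_maximal_weight[OF nz'(2)] by blast
  define N where "N = degree (coeff g j) + degree (coeff h k)"
  \<comment> \<open>Either \<open>i\<close> exceeds \<open>j\<close> or \<open>j + k - i\<close>
    exceeds \<open>k\<close>, so one weight drops strictly. The \<mu>-parts have the same sum, hence
    the degree in \<open>X\<close> falls below \<open>N\<close>.\<close>
  have zero: "coeff (coeff g i * coeff h (j + k - i)) N = 0" if i: "i \<le> j + k" "i \<noteq> j" for i
  proof (cases "coeff g i = 0 \<or> coeff h (j + k - i) = 0")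
    case True
    then show ?thesis by auto
  next
    case False
    have "?w g i + ?w h (j + k - i) < ?w g j + ?w h k"
    proof (cases "j < i")
      case True
      then show ?thesis using j(3)[of i] k(2)[of "j + k - i"] False by simp
    next
      case le: False
      with i have "k < j + k - i" by linarith
      then show ?thesis using j(2)[of i] k(3)[of "j + k - i"] False by fastforce
    qed
    moreover have "real i * \<mu> + real (j + k - i) * \<mu> = real j * \<mu> + real k * \<mu>"
      using i by (simp add: of_nat_diff algebra_simps)
    ultimately have "degree (coeff g i) + degree (coeff h (j + k - i)) < N"
      unfolding gauss_weight_def N_def by linarith
    then show ?thesis
      by (intro coeff_eq_0 le_less_trans[OF degree_mult_le])
  qed
  have "coeff (coeff (g * h) (j + k)) N
      = (\<Sum>i\<le>j + k. coeff (coeff g i * coeff h (j + k - i)) N)"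
    by (simp add: coeff_mult[of g h] coeff_sum)
  also have "\<dots> = (\<Sum>i\<in>{j}. coeff (coeff g i * coeff h (j + k - i)) N)"
    using zero by (intro sum.mono_neutral_right) auto
  also have "\<dots> = lead_coeff (coeff g j) * lead_coeff (coeff h k)"
    by (simp add: N_def coeff_mult_degree_sum)
  finally have c: "coeff (coeff (g * h) (j + k)) N \<noteq> 0" using j(1) k(1) by simp
  then have c0: "coeff (g * h) (j + k) \<noteq> 0" by auto
  have "?w g j + ?w h k \<le> ?w (g * h) (j + k)"
    using le_degree[OF c] by (simp add: gauss_weight_def N_def algebra_simps)
  also have "\<dots> \<le> ?w (g * h) (degree (g * h))"
    using dom c0 by (simp add: lead_dominant_def)
  also have "\<dots> = ?w g (degree g) + ?w h (degree h)"
    using nz' by (simp add: gauss_weight_def degree_mult_eq lead_coeff_mult coeff_mult_degree_sum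
        algebra_simps)
  finally have "?w g j \<le> ?w g (degree g)" using k(2)[of "degree h"] nz' by simp
  then show ?thesis using j(2) unfolding lead_dominant_def by fastforce
qed

section \<open>Degrees of \<open>g(X,a)\<close> and \<open>g(X,b)\<close>\<close>

lemma degree_poly_le_lead_weight:
  fixes g :: "'a::idom poly poly"
  assumes dom: "lead_dominant \<mu> g" and nz: "poly g a \<noteq> 0"
    and a: "a \<noteq> 0 \<Longrightarrow> real (degree a) \<le> \<mu>"
  shows "real (degree (poly g a)) \<le> gauss_weight \<mu> g (degree g)"
proof -
  define N where "N = degree (poly g a)"
  have "coeff (poly g a) N \<noteq> 0" using nz by (simp add: N_def)
  then have "(\<Sum>i\<le>degree g. coeff (coeff g i * a ^ i) N) \<noteq> 0"
    by (simp add: poly_altdef coeff_sum)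
  then obtain i where i: "coeff (coeff g i * a ^ i) N \<noteq> 0" by (meson sum.neutral)
  then have nz': "coeff g i \<noteq> 0" "a ^ i \<noteq> 0" by (metis coeff_0 mult_zero_left mult_zero_right)+
  have "N \<le> degree (coeff g i) + degree (a ^ i)"
    using le_degree[OF i] degree_mult_le le_trans by blast
  \<comment> \<open>If \<open>a = 0\<close>, then \<open>a ^ i \<noteq> 0\<close> forces
    \<open>i = 0\<close>; thus a negative \<mu> does no harm.\<close>
  moreover have "real (degree (a ^ i)) \<le> real i * \<mu>"
  proof (cases "a = 0")
    case True
    then show ?thesis using nz' by (cases i) auto
  next
    case False
    then show ?thesis using a by (simp add: degree_power_eq mult_left_mono)
  qed
  ultimately have "real N \<le> gauss_weight \<mu> g i" by (simp add: gauss_weight_def)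
  also have "\<dots> \<le> gauss_weight \<mu> g (degree g)" using dom nz' by (simp add: lead_dominant_def)
  finally show ?thesis by (simp add: N_def)
qed

text \<open>Since \<open>b\<close> has degree above \<mu>, dominance becomes strict after
  substitution: every lower term has degree below \<open>N\<close>, and the coefficient of
  \<open>X^N\<close> comes from the leading term alone.\<close>

lemma degree_poly_ge_lead_term:
  fixes g :: "'a::idom poly poly"
  assumes dom: "lead_dominant \<mu> g" and nz: "g \<noteq> 0" "b \<noteq> 0" and b: "\<mu> < real (degree b)"
  shows "degree (lead_coeff g) + degree g * degree b \<le> degree (poly g b)"
proof (rule le_degree)
  let ?m = "degree g"
  define N where "N = degree (lead_coeff g) + ?m * degree b"
  have zero: "coeff (coeff g i * b ^ i) N = 0" if i: "i < ?m" for i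
  proof (cases "coeff g i = 0")
    case False
    then have "gauss_weight \<mu> g i \<le> gauss_weight \<mu> g ?m"
      using dom by (simp add: lead_dominant_def)
    moreover have "real (?m - i) * \<mu> < real (?m - i) * real (degree b)"
      using b i by (intro mult_strict_left_mono) auto
    ultimately have
      "real (degree (coeff g i)) + real i * degree b < real (degree (lead_coeff g)) + real ?m * degree b"
      using i by (simp add: gauss_weight_def of_nat_diff algebra_simps)
    then have "real (degree (coeff g i) + i * degree b) < real N" by (simp add: N_def)
    then have "degree (coeff g i) + degree (b ^ i) < N"
      unfolding degree_power_eq[OF nz(2)] of_nat_less_iff .
    then show ?thesis by (intro coeff_eq_0 le_less_trans[OF degree_mult_le])
  qed simp
  have "coeff (poly g b) N = (\<Sum>i\<le>?m. coeff (coeff g i * b ^ i) N)"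
    by (simp add: poly_altdef coeff_sum)
  also have "\<dots> = (\<Sum>i\<in>{?m}. coeff (coeff g i * b ^ i) N)"
    using zero by (intro sum.mono_neutral_right) auto
  also have "\<dots> = lead_coeff (lead_coeff g) * lead_coeff (b ^ ?m)"
    using nz coeff_mult_degree_sum[of "lead_coeff g" "b ^ ?m"]
    by (simp add: N_def degree_power_eq)
  also have "\<dots> \<noteq> 0" using nz by simp
  finally show "coeff (poly g b) (degree (lead_coeff g) + ?m * degree b) \<noteq> 0"
    by (simp add: N_def)
qed

lemma degree_poly_increment:
  fixes g :: "'a::idom poly poly"
  assumes dom: "lead_dominant \<mu> g" and g: "degree g > 0" and nz: "poly g a \<noteq> 0" "b \<noteq> 0"
    and a: "a \<noteq> 0 \<Longrightarrow> real (degree a) \<le> \<mu>" and b: "\<mu> < real (degree b)"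
  shows "real (degree b) - \<mu> \<le> real (degree (poly g b)) - real (degree (poly g a))"
proof -
  let ?m = "real (degree g)"
  have g0: "g \<noteq> 0" using g by auto
  have "real (degree (lead_coeff g) + degree g * degree b) \<le> real (degree (poly g b))"
    using degree_poly_ge_lead_term[OF dom g0 nz(2) b] by (simp only: of_nat_le_iff)
  moreover have "real (degree (poly g a)) \<le> real (degree (lead_coeff g)) + ?m * \<mu>"
    using degree_poly_le_lead_weight[OF dom nz(1) a] by (simp add: gauss_weight_def)
  ultimately have incr: "?m * (real (degree b) - \<mu>) \<le> real (degree (poly g b)) - real (degree (poly g a))"
    by (simp add: algebra_simps)
  \<comment> \<open>Dropping the factor \<open>degree g\<close>, which is at least 1, leaves a bound
    that is the same for all factors.\<close>
  have "1 * (real (degree b) - \<mu>) \<le> ?m * (real (degree b) - \<mu>)"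
    using g b by (intro mult_right_mono) auto
  also note incr
  finally show ?thesis by simp
qed

text \<open>The maximum is a real number even if \<open>a\<close> or some \<open>a\<^sub>i\<close> vanishes, because \<open>a\<^sub>0 \<noteq> 0\<close>.\<close>

lemma slope_bound_real:
  fixes f :: "'a::zero poly poly" and a :: "'a poly"
  assumes n: "n \<ge> 1" "degree f = n" and nz: "coeff f 0 \<noteq> 0" "coeff f n \<noteq> 0"
  defines "m \<equiv> max (edegree a)
    (MAX i\<in>{0..n - 1}. (edegree (coeff f i) - edegree (coeff f n)) / ereal (real (n - i)))"
  obtains \<mu> where "m = ereal \<mu>" "a \<noteq> 0 \<Longrightarrow> real (degree a) \<le> \<mu>" "lead_dominant \<mu> f"
proof -
  let ?s = "\<lambda>i. (edegree (coeff f i) - edegree (coeff f n)) / ereal (real (n - i))"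
  let ?r = "\<lambda>i. (real (degree (coeff f i)) - real (degree (coeff f n))) / real (n - i)"
  have s: "?s i = ereal (?r i)" if "coeff f i \<noteq> 0" "i < n" for i
    using that nz by (simp add: edegree_def)
  have s': "?s i = - \<infinity>" if "coeff f i = 0" "i < n" for i
    using that nz by (simp add: edegree_def)
  have M: "?s i \<le> m" if "i < n" for i
    unfolding m_def using that n by (intro max.coboundedI2 Max_ge) auto
  have "m \<in> insert (edegree a) (?s ` {0..n - 1})"
    unfolding m_def max_def using Max_in[of "?s ` {0..n - 1}"] by auto
  moreover have "?s i \<noteq> \<infinity>" if "i \<in> {0..n - 1}" for i
    using s[of i] s'[of i] that n by (cases "coeff f i = 0") auto
  moreover have "edegree a \<noteq> \<infinity>" by (simp add: edegree_def)
  ultimately have "m \<noteq> \<infinity>" by (metis (no_types, lifting) imageE insertE)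
  moreover have "m \<noteq> - \<infinity>" using M[of 0] s[of 0] nz n by auto
  ultimately obtain \<mu> where \<mu>: "m = ereal \<mu>" by (cases m) auto
  have "edegree a \<le> m" unfolding m_def by simp
  then have "real (degree a) \<le> \<mu>" if "a \<noteq> 0" using that \<mu> by (simp add: edegree_def)
  moreover have "lead_dominant \<mu> f"
    unfolding lead_dominant_def n(2)
  proof (intro allI impI)
    fix i assume i: "coeff f i \<noteq> 0"
    then have "i \<le> n" using le_degree n(2) by blast
    then consider "i = n" | "i < n" by linarith
    then show "gauss_weight \<mu> f i \<le> gauss_weight \<mu> f n"
    proof cases
      case 2
      \<comment> \<open>Multiplied by \<open>n - i > 0\<close>, the bound on the slope is exactly
        dominance over the term of index \<open>i\<close>.\<close>
      then have "?r i \<le> \<mu>" using M[of i] s[of i] i \<mu> by simp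
      then show ?thesis using 2
        by (simp add: gauss_weight_def pos_divide_le_eq of_nat_diff algebra_simps)
    qed simp
  qed
  ultimately show thesis using that \<mu> by blast
qed

theorem theorem1p9:
  fixes f :: "'a::field poly poly" and a b :: "'a poly"
    and n :: nat and \<Delta> :: real and q :: int
  assumes "n \<ge> 1" and "degree f = n" and "coeff f 0 * coeff f n \<noteq> 0"
    and "poly f a * poly f b \<noteq> 0"
    and "\<Delta> = 1 / 2 * (real (degree (poly f b)) - real (degree (poly f a)))"
    and "\<Delta> \<ge> 0"
    and "q = Max (admissible_degree_diffs f a b \<Delta>)"
    and "edegree b >
      max (edegree a)
        (MAX i\<in>{0..n - 1}.
          (edegree (coeff f i) - edegree (coeff f n)) / ereal (real (n - i)))
      + ereal (real_of_int q)"
  shows "irreducible (fract_poly f)"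
proof -
  have nz: "coeff f 0 \<noteq> 0" "coeff f n \<noteq> 0" "poly f a \<noteq> 0" "poly f b \<noteq> 0"
    using assms(3,4) by auto
  then have f0: "f \<noteq> 0" by auto
  have q_ge: "k \<le> q" if "k \<in> admissible_degree_diffs f a b \<Delta>" for k
    unfolding assms(7) using that finite_admissible_degree_diffs[OF nz(3,4)] by (rule Max_ge[rotated])
  \<comment> \<open>The pair of divisors \<open>1\<close>, \<open>1\<close> gives the difference 0.
    Together with the degree hypothesis this yields \<open>\<mu> < degree b\<close>.\<close>
  have q0: "0 \<le> q" using q_ge zero_in_admissible_degree_diffs assms(6) by blast
  obtain \<mu> where \<mu>: "max (edegree a)
        (MAX i\<in>{0..n - 1}.
          (edegree (coeff f i) - edegree (coeff f n)) / ereal (real (n - i))) = ereal \<mu>"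
    and a: "a \<noteq> 0 \<Longrightarrow> real (degree a) \<le> \<mu>" and dom: "lead_dominant \<mu> f"
    using slope_bound_real[OF assms(1,2) nz(1,2), of a] by blast
  \<comment> \<open>The right-hand side is finite, which rules out
    \<open>edegree b = - \<infinity>\<close>.\<close>
  have b: "b \<noteq> 0" "\<mu> + real_of_int q < real (degree b)"
    using assms(8) unfolding \<mu> by (auto simp: edegree_def split: if_splits)
  \<comment> \<open>An increment of at most \<Delta> would be among the differences that define
    \<open>q\<close>, whereas it is at least \<open>degree b - \<mu>\<close>, which exceeds
    \<open>q\<close>.\<close>
  have large: "\<Delta> < real (degree (poly g b)) - real (degree (poly g a))"
    if gh: "f = g * h" and g: "degree g > 0" for g h
  proof (rule ccontr)
    let ?k = "int (degree (poly g b)) - int (degree (poly g a))"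
    assume "\<not> ?thesis"
    then have "?k \<in> admissible_degree_diffs f a b \<Delta>"
      unfolding admissible_degree_diffs_def
      using poly_factor_admissible[OF gh nz(3)] poly_factor_admissible[OF gh nz(4)]
      by (intro CollectI exI[of _ "poly g a"] exI[of _ "poly g b"]) auto
    then have "real_of_int ?k \<le> real_of_int q" using q_ge by (simp only: of_int_le_iff)
    moreover have "lead_dominant \<mu> g" using dom f0 lead_dominant_factor gh by blast
    then have "real (degree b) - \<mu> \<le> real (degree (poly g b)) - real (degree (poly g a))"
      using g gh nz(3) b q0 a by (intro degree_poly_increment) auto
    ultimately show False using b(2) by simp
  qed
  show ?thesis
  proof (rule irreducibleI)
    show "fract_poly f \<noteq> 0" using f0 by simp
    then show "\<not> fract_poly f dvd 1"
      using assms(1,2) by (simp add: is_unit_iff_degree degree_map_poly)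
  next
    fix G H assume GH: "fract_poly f = G * H"
    then have GH0: "G \<noteq> 0" "H \<noteq> 0" using f0 by (metis fract_poly_eq_0_iff mult_eq_0_iff)+
    obtain g h where gh: "f = g * h" "degree g = degree G" "degree h = degree H"
      using fract_poly_factorization[OF GH] .
    have "degree g = 0 \<or> degree h = 0"
    proof (rule ccontr)
      \<comment> \<open>With both degrees positive, \<open>large\<close> applies to each factor, but
        the two increments sum to exactly \<open>2 * \<Delta>\<close>.\<close>
      assume "\<not> ?thesis"
      then have "2 * \<Delta> < real (degree (poly g b)) - real (degree (poly g a)) +
          (real (degree (poly h b)) - real (degree (poly h a)))"
        using large[of g h] large[of h g] gh(1) by (simp add: mult.commute)
      also have "\<dots> = 2 * \<Delta>"
        using nz(3,4) gh(1) unfolding assms(5) by (simp add: degree_mult_eq)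
      finally show False by simp
    qed
    then show "G dvd 1 \<or> H dvd 1" using GH0 gh by (simp add: is_unit_iff_degree)
  qed
qed

end
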